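(* The transformation DL-Recursion (described in the context) transforms any diagonal $S_D$ of order $n$ into a straight line $S_L$ of the same order (all nodes in consecutive cells of one row or column) in $O(n\log n)$ line moves.
   Context: Nodes occupy distinct cells of the two-dimensional square grid, cells addressed by integer coordinates $(x,y)$. A shape is a finite set of nodes; its order is its number of nodes. A line is a set of one or more nodes occupying consecutive cells of one row or column. A line move (one step): a line of $k\ge1$ nodes occupying $(x_1,y),\dots,(x_1+k-1,y)$ may move right by one cell if $(x_1+k,y)$ is empty, or left by one cell if $(x_1-1,y)$ is empty; vertical lines move up/down analogously; all nodes move simultaneously. Connectivity need not be preserved. A diagonal of order $n$ is a shape with nodes at $(x+j,y+j)$, $j=0,\dots,n-1$. DL-Recursion: partition the diagonal into two diagonals of length $n/2$ each; recursively transform each half into a line of length $n/2$ by the same halving procedure (recursion ending at single nodes); then move the line obtained from the top-right half, paying at most $2n$ line moves, to merge with the line obtained from the bottom-left half into a single line of length $n$. *)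

theory Defs
  imports Complex_Main "HOL-Library.Landau_Symbols"
begin

type_synonym cell = "int \<times> int"
type_synonym shape = "cell set"

definition hline :: "int \<Rightarrow> int \<Rightarrow> nat \<Rightarrow> shape" where
  "hline x y k = (\<lambda>i. (x + int i, y)) ` {..<k}"

definition vline :: "int \<Rightarrow> int \<Rightarrow> nat \<Rightarrow> shape" where
  "vline x y k = (\<lambda>i. (x, y + int i)) ` {..<k}"

definition is_line :: "shape \<Rightarrow> bool" where
  "is_line S \<longleftrightarrow> (\<exists>x y k. k \<ge> 1 \<and> (S = hline x y k \<or> S = vline x y k))"

definition diagonal :: "int \<Rightarrow> int \<Rightarrow> nat \<Rightarrow> shape" where
  "diagonal x y n = (\<lambda>j. (x + int j, y + int j)) ` {..<n}"

datatype direction = Rightward | Leftward | Upward | Downward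

text \<open>
  \<open>Move d x y k\<close> moves the line of \<open>k\<close> nodes whose leftmost (for horizontal \<open>d\<close>) or bottommost
  (for vertical \<open>d\<close>) cell is \<open>(x, y)\<close> by one cell in direction \<open>d\<close>.  The line need not be a
  maximal run of nodes.
\<close>

datatype move = Move direction int int nat

fun line_before :: "move \<Rightarrow> shape" where
  "line_before (Move Rightward x y k) = hline x y k"
| "line_before (Move Leftward x y k) = hline x y k"
| "line_before (Move Upward x y k) = vline x y k"
| "line_before (Move Downward x y k) = vline x y k"

fun line_after :: "move \<Rightarrow> shape" where
  "line_after (Move Rightward x y k) = hline (x + 1) y k"
| "line_after (Move Leftward x y k) = hline (x - 1) y k"
| "line_after (Move Upward x y k) = vline x (y + 1) k"
| "line_after (Move Downward x y k) = vline x (y - 1) k"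

fun cell_ahead :: "move \<Rightarrow> cell" where
  "cell_ahead (Move Rightward x y k) = (x + int k, y)"
| "cell_ahead (Move Leftward x y k) = (x - 1, y)"
| "cell_ahead (Move Upward x y k) = (x, y + int k)"
| "cell_ahead (Move Downward x y k) = (x, y - 1)"

fun move_size :: "move \<Rightarrow> nat" where
  "move_size (Move d x y k) = k"

definition line_move :: "shape \<Rightarrow> move \<Rightarrow> shape \<Rightarrow> bool" where
  "line_move S mv S' \<longleftrightarrow>
     move_size mv \<ge> 1 \<and> line_before mv \<subseteq> S \<and> cell_ahead mv \<notin> S \<and>
     S' = (S - line_before mv) \<union> line_after mv"

fun transforms :: "shape \<Rightarrow> move list \<Rightarrow> shape \<Rightarrow> bool" where
  "transforms S [] S' \<longleftrightarrow> S' = S"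
| "transforms S (mv # mvs) S' \<longleftrightarrow> (\<exists>S''. line_move S mv S'' \<and> transforms S'' mvs S')"

text \<open>
  \<open>turn_down c r k\<close> turns the horizontal line of \<open>k\<close> nodes with left end \<open>(c, r)\<close> into the vertical
  line with top end \<open>(c, r)\<close>: alternately the vertical part is pushed down one cell and the rest of
  the horizontal part is pulled left over the corner \<open>(c, r)\<close>.
\<close>

definition turn_down :: "int \<Rightarrow> int \<Rightarrow> nat \<Rightarrow> move list" where
  "turn_down c r k = concat (map (\<lambda>i.
     [Move Downward c (r - int i) (i + 1), Move Leftward (c + 1) r (k - 1 - i)]) [0..<k - 1])"

definition push_down :: "int \<Rightarrow> int \<Rightarrow> nat \<Rightarrow> nat \<Rightarrow> move list" where
  "push_down c r k d = map (\<lambda>i. Move Downward c (r - int i) k) [0..<d]"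

text \<open>
  \<open>turn_right c r k\<close> turns the vertical line of \<open>k\<close> nodes with bottom end \<open>(c, r)\<close> into the
  horizontal line with left end \<open>(c, r)\<close>.
\<close>

definition turn_right :: "int \<Rightarrow> int \<Rightarrow> nat \<Rightarrow> move list" where
  "turn_right c r k = concat (map (\<lambda>i.
     [Move Rightward c r (i + 1), Move Downward c (r + 1) (k - 1 - i)]) [0..<k - 1])"

text \<open>
  A line of \<open>l\<close> nodes with left end \<open>(x + m, y + m)\<close> is brought to left end \<open>(x + m, y)\<close>, where it
  continues the line of \<open>m\<close> nodes with left end \<open>(x, y)\<close>.  It turns downwards, is pushed to row \<open>y\<close>
  and turns back.  Only \<open>l = m\<close> and \<open>l = m + 1\<close> occur.
\<close>

definition merge_lines :: "int \<Rightarrow> int \<Rightarrow> nat \<Rightarrow> nat \<Rightarrow> move list" where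
  "merge_lines x y m l =
     turn_down (x + int m) (y + int m) l @
     push_down (x + int m) (y + int m - int (l - 1)) l (m + 1 - l) @
     turn_right (x + int m) y l"

text \<open>
  The moves of DL-Recursion on \<open>diagonal x y n\<close>.  For odd \<open>n\<close> the bottom-left half gets
  \<open>n div 2\<close> nodes and the top-right half the remaining ones.
\<close>

function dl_recursion :: "int \<Rightarrow> int \<Rightarrow> nat \<Rightarrow> move list" where
  "dl_recursion x y n =
     (if n \<le> 1 then []
      else let m = n div 2; l = n - m in
        dl_recursion x y m @
        dl_recursion (x + int m) (y + int m) l @
        merge_lines x y m l)"
  by auto
termination by (relation "measure (\<lambda>(x, y, n). n)") auto

declare dl_recursion.simps [simp del]

lemma length_turn_down: "length (turn_down c r k) = 2 * (k - 1)"
  by (simp add: turn_down_def length_concat comp_def sum_list_triv)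

lemma length_turn_right: "length (turn_right c r k) = 2 * (k - 1)"
  by (simp add: turn_right_def length_concat comp_def sum_list_triv)

lemma length_merge_lines:
  "length (merge_lines x y m l) = 4 * (l - 1) + (m + 1 - l)"
  by (simp add: merge_lines_def length_turn_down length_turn_right push_down_def)

lemma length_merge_lines_le:
  assumes "n \<ge> 2"
  shows "length (merge_lines x y (n div 2) (n - n div 2)) \<le> 2 * n"
  using assms by (simp add: length_merge_lines)

end

(* Every line move only enters the cell ahead of it, and during DL-Recursion on the diagonal at (x, y)
   of order n that cell always lies in the square of side n with lower left corner (x, y).  Nodes
   outside this square are therefore irrelevant, so the two halves can be transformed independently of
   each other.  A merge costs at most 2n moves, and the halving has depth at most the ceiling of
   log 2 n, since n <= 2 ^ Suc d implies that both halves have order at most 2 ^ d. *)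
theory Submission
  imports Defs
begin

text \<open>As simp rules, this and the next two characterisations reduce claims about shapes and
  positions to linear integer arithmetic. The witness \<open>nat (a - x)\<close> is the index of the
  cell in the line.\<close>

lemma mem_hline [simp]: "(a, b) \<in> hline x y k \<longleftrightarrow> b = y \<and> x \<le> a \<and> a < x + int k"
proof
  assume "b = y \<and> x \<le> a \<and> a < x + int k"
  then show "(a, b) \<in> hline x y k"
    by (auto simp: hline_def intro!: image_eqI[of _ _ "nat (a - x)"])
qed (auto simp: hline_def)

lemma mem_vline [simp]: "(a, b) \<in> vline x y k \<longleftrightarrow> a = x \<and> y \<le> b \<and> b < y + int k"
proof
  assume "a = x \<and> y \<le> b \<and> b < y + int k"
  then show "(a, b) \<in> vline x y k"
    by (auto simp: vline_def intro!: image_eqI[of _ _ "nat (b - y)"])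
qed (auto simp: vline_def)

lemma mem_diagonal [simp]: "(a, b) \<in> diagonal x y n \<longleftrightarrow> b - y = a - x \<and> x \<le> a \<and> a < x + int n"
proof
  assume "b - y = a - x \<and> x \<le> a \<and> a < x + int n"
  then show "(a, b) \<in> diagonal x y n"
    by (auto simp: diagonal_def intro!: image_eqI[of _ _ "nat (a - x)"])
qed (auto simp: diagonal_def)

lemma card_hline [simp]: "card (hline x y k) = k"
  unfolding hline_def by (subst card_image) (auto simp: inj_on_def)

definition square :: "int \<Rightarrow> int \<Rightarrow> nat \<Rightarrow> shape" where
  "square x y n = {x..<x + int n} \<times> {y..<y + int n}"

lemma diagonal_subset_square: "diagonal x y n \<subseteq> square x y n"
  by (auto simp: square_def)

lemma diagonal_1: "diagonal x y (Suc 0) = hline x y (Suc 0)"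
  by auto

lemma diagonal_add: "diagonal x y (m + l) = diagonal x y m \<union> diagonal (x + int m) (y + int m) l"
  by auto

lemma hline_add: "hline x y (m + l) = hline x y m \<union> hline (x + int m) y l"
  by auto

text \<open>This is why it suffices to track \<open>cell_ahead\<close> alone when confining a run of
  moves to a region.\<close>

lemma line_after_subset: "line_after mv \<subseteq> insert (cell_ahead mv) (line_before mv)"
  by (cases mv rule: line_before.cases) auto

lemma transforms_append:
  "transforms S (ms @ ms') S'' \<longleftrightarrow> (\<exists>S'. transforms S ms S' \<and> transforms S' ms' S'')"
  by (induction ms arbitrary: S) auto

text \<open>A frame rule. A move takes nodes only from its line, which lies in \<open>A\<close> and
  hence in \<open>R\<close>, and tests only its cell ahead, also in \<open>R\<close>. Nodes in
  \<open>F\<close> can therefore neither block a move nor be moved.\<close>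

lemma transforms_frame:
  assumes "transforms A mvs B" "A \<subseteq> R" "cell_ahead ` set mvs \<subseteq> R" "F \<inter> R = {}"
  shows "transforms (A \<union> F) mvs (B \<union> F)"
  using assms
proof (induction mvs arbitrary: A)
  case (Cons mv mvs)
  then obtain A' where A': "line_move A mv A'" "transforms A' mvs B"
    by auto
  \<comment> \<open>Confinement to \<open>R\<close> has to be re-established after each move for the
    induction to go on.\<close>
  have "A' \<subseteq> R"
    using A'(1) Cons.prems(2,3) line_after_subset[of mv] by (simp add: line_move_def) blast
  moreover have "line_move (A \<union> F) mv (A' \<union> F)"
    using A'(1) Cons.prems by (auto simp: line_move_def)
  ultimately show ?case
    using Cons.IH[OF A'(2)] Cons.prems by auto
qed simp

lemma transforms_turn_down:
  assumes "k \<ge> 1"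
  shows "transforms (hline c r k) (turn_down c r k) (vline c (r - int (k - 1)) k)"
proof -
  let ?moves = "\<lambda>i. [Move Downward c (r - int i) (i + 1), Move Leftward (c + 1) r (k - 1 - i)]"
  \<comment> \<open>After \<open>j\<close> rounds the shape is an L whose corner
    \<open>(c, r)\<close> is counted with the vertical arm. In \<open>?mid\<close> the corner is
    vacant, so the horizontal arm can be pulled into it.\<close>
  let ?state = "\<lambda>j. vline c (r - int j) (j + 1) \<union> hline (c + 1) r (k - 1 - j)"
  have "transforms (hline c r k) (concat (map ?moves [0..<j])) (?state j)" if "j \<le> k - 1" for j
    using that
  proof (induction j)
    case 0
    then show ?case using assms by auto
  next
    case (Suc j)
    let ?mid = "vline c (r - int j - 1) (j + 1) \<union> hline (c + 1) r (k - 1 - j)"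
    have "line_move (?state j) (Move Downward c (r - int j) (j + 1)) ?mid"
      using Suc.prems by (auto simp: line_move_def)
    moreover have "line_move ?mid (Move Leftward (c + 1) r (k - 1 - j)) (?state (Suc j))"
      using Suc.prems by (auto simp: line_move_def)
    ultimately have "transforms (?state j) (?moves j) (?state (Suc j))"
      by auto
    then show ?case
      using Suc by (auto simp: transforms_append simp del: transforms.simps)
  qed
  \<comment> \<open>After \<open>k - 1\<close> rounds the horizontal arm is empty; unfolding
    \<open>hline_def\<close> lets simp see this.\<close>
  from this[of "k - 1"] show ?thesis
    using assms by (simp add: turn_down_def hline_def)
qed

lemma transforms_push_down:
  assumes "k \<ge> 1"
  shows "transforms (vline c r k) (push_down c r k d) (vline c (r - int d) k)"
proof (induction d)
  case (Suc d)
  have "line_move (vline c (r - int d) k) (Move Downward c (r - int d) k) (vline c (r - int (Suc d)) k)"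
    using assms by (auto simp: line_move_def)
  then show ?case
    using Suc by (auto simp: push_down_def transforms_append)
qed (simp add: push_down_def)

lemma transforms_turn_right:
  assumes "k \<ge> 1"
  shows "transforms (vline c r k) (turn_right c r k) (hline c r k)"
proof -
  let ?moves = "\<lambda>i. [Move Rightward c r (i + 1), Move Downward c (r + 1) (k - 1 - i)]"
  \<comment> \<open>The same L-shaped invariant with the arms exchanged: the corner now counts with
    the horizontal arm.\<close>
  let ?state = "\<lambda>j. hline c r (j + 1) \<union> vline c (r + 1) (k - 1 - j)"
  have "transforms (vline c r k) (concat (map ?moves [0..<j])) (?state j)" if "j \<le> k - 1" for j
    using that
  proof (induction j)
    case 0
    then show ?case using assms by auto
  next
    case (Suc j)
    let ?mid = "hline (c + 1) r (j + 1) \<union> vline c (r + 1) (k - 1 - j)"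
    have "line_move (?state j) (Move Rightward c r (j + 1)) ?mid"
      using Suc.prems by (auto simp: line_move_def)
    moreover have "line_move ?mid (Move Downward c (r + 1) (k - 1 - j)) (?state (Suc j))"
      using Suc.prems by (auto simp: line_move_def)
    ultimately have "transforms (?state j) (?moves j) (?state (Suc j))"
      by auto
    then show ?case
      using Suc by (auto simp: transforms_append simp del: transforms.simps)
  qed
  from this[of "k - 1"] show ?thesis
    using assms by (simp add: turn_right_def vline_def)
qed

lemma transforms_merge_lines:
  assumes "1 \<le> l" "l \<le> m + 1"
  shows "transforms (hline (x + int m) (y + int m) l) (merge_lines x y m l) (hline (x + int m) y l)"
proof -
  let ?c = "x + int m" and ?r = "y + int m - int (l - 1)"
  have "?r - int (m + 1 - l) = y"
    using assms by simp
  then have "transforms (vline ?c ?r l) (push_down ?c ?r l (m + 1 - l)) (vline ?c y l)"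
    using transforms_push_down[of l ?c ?r "m + 1 - l"] assms by simp
  then show ?thesis
    using transforms_turn_down transforms_turn_right assms
    unfolding merge_lines_def transforms_append by blast
qed

text \<open>The rectangle spans only the columns of the top-right half, so it avoids the line
  already built from the bottom-left half.\<close>

lemma cell_ahead_merge_lines:
  assumes "1 \<le> l" "l \<le> m + 1"
  shows "cell_ahead ` set (merge_lines x y m l)
           \<subseteq> {x + int m..<x + int m + int l} \<times> {y..<y + int m + int l}"
  using assms by (auto simp: merge_lines_def turn_down_def push_down_def turn_right_def)

lemma cell_ahead_dl_recursion: "cell_ahead ` set (dl_recursion x y n) \<subseteq> square x y n"
proof (induction x y n rule: dl_recursion.induct)
  case (1 x y n)
  show ?case
  proof (cases "n \<le> 1")
    case False
    define m l where "m = n div 2" and "l = n - m"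
    have ml: "1 \<le> l" "l \<le> m + 1" "n = m + l"
      using False by (auto simp: m_def l_def)
    have "square x y m \<subseteq> square x y n" "square (x + int m) (y + int m) l \<subseteq> square x y n"
      "{x + int m..<x + int m + int l} \<times> {y..<y + int m + int l} \<subseteq> square x y n"
      by (auto simp: square_def ml)
    then show ?thesis
      using False 1[OF False m_def l_def] cell_ahead_merge_lines[OF ml(1,2), of x y]
      by (subst dl_recursion.simps) (simp add: Let_def image_Un flip: m_def l_def, blast)
  qed (simp add: dl_recursion.simps)
qed

lemma transforms_dl_recursion:
  assumes "n \<ge> 1"
  shows "transforms (diagonal x y n) (dl_recursion x y n) (hline x y n)"
  using assms
proof (induction x y n rule: dl_recursion.induct)
  case (1 x y n)
  show ?case
  proof (cases "n \<le> 1")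
    case True
    then have "n = Suc 0"
      using 1(3) by simp
    then show ?thesis
      by (simp add: dl_recursion.simps diagonal_1)
  next
    case False
    define m l where "m = n div 2" and "l = n - m"
    have ml: "1 \<le> m" "1 \<le> l" "l \<le> m + 1" "n = m + l"
      using False by (auto simp: m_def l_def)
    let ?x = "x + int m" and ?y = "y + int m"
    \<comment> \<open>The untouched top-right diagonal is the frame here. In the next two steps the
      frame is the finished bottom-left line, which lies to the left of column
      \<open>?x\<close>.\<close>
    have "transforms (diagonal x y m \<union> diagonal ?x ?y l) (dl_recursion x y m)
            (hline x y m \<union> diagonal ?x ?y l)"
    proof (rule transforms_frame)
      show "transforms (diagonal x y m) (dl_recursion x y m) (hline x y m)"
        using 1(1)[OF False m_def l_def] ml by simp
      show "diagonal ?x ?y l \<inter> square x y m = {}"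
        by (auto simp: square_def)
    qed (rule diagonal_subset_square cell_ahead_dl_recursion)+
    moreover have "transforms (diagonal ?x ?y l \<union> hline x y m) (dl_recursion ?x ?y l)
                     (hline ?x ?y l \<union> hline x y m)"
    proof (rule transforms_frame)
      show "transforms (diagonal ?x ?y l) (dl_recursion ?x ?y l) (hline ?x ?y l)"
        using 1(2)[OF False m_def l_def] ml by simp
      show "hline x y m \<inter> square ?x ?y l = {}"
        by (auto simp: square_def)
    qed (rule diagonal_subset_square cell_ahead_dl_recursion)+
    moreover have "transforms (hline ?x ?y l \<union> hline x y m) (merge_lines x y m l)
                     (hline ?x y l \<union> hline x y m)"
      by (rule transforms_frame[OF transforms_merge_lines[OF ml(2,3)] _
            cell_ahead_merge_lines[OF ml(2,3)]])
        auto
    ultimately have "transforms (diagonal x y n)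
        (dl_recursion x y m @ dl_recursion ?x ?y l @ merge_lines x y m l) (hline x y n)"
      \<comment> \<open>The frame rule lists the moving part first, so the unions must be commuted
        before the three runs compose.\<close>
      unfolding transforms_append ml(4) diagonal_add hline_add by (metis Un_commute)
    then show ?thesis
      using False by (subst dl_recursion.simps) (simp add: Let_def flip: m_def l_def)
  qed
qed

text \<open>Induction on a depth bound \<open>d\<close> rather than on \<open>n\<close> gives both
  halves of an odd \<open>n\<close> the same bound. Each level adds at most two moves per
  node.\<close>

lemma length_dl_recursion_le:
  assumes "n \<le> 2 ^ d"
  shows "length (dl_recursion x y n) \<le> 2 * n * d"
  using assms
proof (induction d arbitrary: x y n)
  case 0
  then show ?case by (simp add: dl_recursion.simps)
next
  case (Suc d)
  show ?case
  proof (cases "n \<le> 1")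
    case False
    define m l where "m = n div 2" and "l = n - m"
    have ml: "m \<le> 2 ^ d" "l \<le> 2 ^ d" "n = m + l"
      using Suc.prems by (auto simp: m_def l_def)
    have "length (dl_recursion x y n) = length (dl_recursion x y m)
        + length (dl_recursion (x + int m) (y + int m) l) + length (merge_lines x y m l)"
      using False by (subst dl_recursion.simps) (simp add: Let_def flip: m_def l_def)
    also have "\<dots> \<le> 2 * m * d + 2 * l * d + 2 * n"
      using Suc.IH ml(1,2) length_merge_lines_le[of n x y] False
      unfolding m_def[symmetric] l_def[symmetric] by (intro add_mono) auto
    also have "\<dots> = 2 * n * Suc d"
      by (simp add: ml(3) algebra_simps)
    finally show ?thesis .
  qed (simp add: dl_recursion.simps)
qed

lemma le_two_power_ceiling_log: "n \<le> 2 ^ nat \<lceil>log 2 (real n)\<rceil>"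
\<comment> \<open>Zero is separate because \<open>2 powr log 2 (real n)\<close> is positive and so
  cannot equal it.\<close>
proof (cases "n = 0")
  case False
  then have "real n = 2 powr log 2 (real n)"
    by simp
  also have "\<dots> \<le> 2 powr real (nat \<lceil>log 2 (real n)\<rceil>)"
    by (intro powr_mono real_nat_ceiling_ge) simp
  also have "\<dots> = real (2 ^ nat \<lceil>log 2 (real n)\<rceil>)"
    by (simp add: powr_realpow)
  finally show ?thesis
    by (simp only: of_nat_le_iff)
qed simp

theorem theorem3p16:
  "\<exists>T :: nat \<Rightarrow> nat.
     (\<lambda>n. real (T n)) \<in> O(\<lambda>n. real n * log 2 (real n)) \<and>
     (\<forall>n \<ge> 1. \<forall>x y :: int. \<exists>S\<^sub>L :: shape.
        transforms (diagonal x y n) (dl_recursion x y n) S\<^sub>L \<and>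
        is_line S\<^sub>L \<and> card S\<^sub>L = n \<and>
        length (dl_recursion x y n) \<le> T n)"
proof (intro exI conjI allI impI)
  let ?T = "\<lambda>n. 2 * n * nat \<lceil>log 2 (real n)\<rceil>"
  show "(\<lambda>n. real (?T n)) \<in> O(\<lambda>n. real n * log 2 (real n))"
  \<comment> \<open>From \<open>n = 2\<close> on the logarithm is at least 1, so rounding up at most
    doubles it; with the factor 2 in \<open>?T\<close> this gives 4.\<close>
  proof (rule bigoI[where c = 4], rule eventually_sequentiallyI)
    fix n :: nat
    assume "2 \<le> n"
    then have "1 \<le> log 2 (real n)"
      by simp
    then have "real (nat \<lceil>log 2 (real n)\<rceil>) \<le> 2 * log 2 (real n)"
      by linarith
    then have "2 * real n * real (nat \<lceil>log 2 (real n)\<rceil>) \<le> 2 * real n * (2 * log 2 (real n))"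
      by (intro mult_left_mono) auto
    then show "norm (real (?T n)) \<le> 4 * norm (real n * log 2 (real n))"
      using \<open>1 \<le> log 2 (real n)\<close> by (simp add: abs_mult)
  qed
  fix n :: nat and x y :: int
  assume "n \<ge> 1"
  then show "transforms (diagonal x y n) (dl_recursion x y n) (hline x y n)"
    by (rule transforms_dl_recursion)
  show "is_line (hline x y n)"
    using \<open>n \<ge> 1\<close> by (auto simp: is_line_def)
  show "card (hline x y n) = n"
    by simp
  show "length (dl_recursion x y n) \<le> ?T n"
    by (rule length_dl_recursion_le[OF le_two_power_ceiling_log])
qed

end
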